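(* Let $\xi\in L^\infty(D)$ be a complex scalar field written as $\xi(\mathbf{x})=|\xi(\mathbf{x})|\,e^{i\varphi_\xi(\mathbf{x})}$ with $\varphi_\xi(\mathbf{x})\in[\varphi_-,\varphi_+]\subset\mathbb{R}$ for almost every $\mathbf{x}\in D$. If $\inf_{\mathbf{x}\in D}|\xi(\mathbf{x})|>0$ and $\varphi_+-\varphi_-<\pi$, then the field $\xi$ is elliptic and every angle $$\theta_\xi\in\bigcup_{n\in\mathbb{Z}}\,\big]2n\pi-\pi/2-\varphi_-,\ 2n\pi+\pi/2-\varphi_+\big[$$ is an ellipticity direction of $\xi$.
   Context: $D\subset\mathbb{R}^3$ is a bounded measurable set of positive measure. A scalar field $\xi=|\xi|e^{i\varphi_\xi}\in L^\infty(D)$ (complex-valued, $\varphi_\xi$ real-valued) is called elliptic if there exist $\theta_\xi\in\mathbb{R}$ and $\xi_->0$ such that $|\xi(\mathbf{x})|\cos(\theta_\xi+\varphi_\xi(\mathbf{x}))\ge\xi_-$ for almost every $\mathbf{x}\in D$. An ellipticity direction of $\xi$ is an angle $\theta_\xi\in\mathbb{R}$ for which there exists $\xi_->0$ such that this inequality holds a.e. in $D$. Open intervals are written $]a,b[$. *)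

theory Defs
  imports "HOL-Analysis.Analysis" "HOL-Probability.Essential_Supremum"
begin

text \<open>Representatives of elements of \<open>L\<^sup>\<infinity>(D)\<close>; values outside \<open>D\<close> are irrelevant.\<close>

definition L_infinity :: "(real^3) set \<Rightarrow> (real^3 \<Rightarrow> complex) \<Rightarrow> bool" where
  "L_infinity D \<xi> \<longleftrightarrow>
     \<xi> \<in> borel_measurable (lebesgue_on D) \<and>
     esssup (lebesgue_on D) (\<lambda>x. ereal (cmod (\<xi> x))) < \<infinity>"

definition essinf :: "'a measure \<Rightarrow> ('a \<Rightarrow> ereal) \<Rightarrow> ereal" where
  "essinf M f = - esssup M (\<lambda>x. - f x)"

definition phase_of :: "(real^3) set \<Rightarrow> (real^3 \<Rightarrow> complex) \<Rightarrow> (real^3 \<Rightarrow> real) \<Rightarrow> bool" where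
  "phase_of D \<xi> \<phi> \<longleftrightarrow>
     (AE x in lebesgue_on D. \<xi> x = of_real (cmod (\<xi> x)) * exp (\<i> * of_real (\<phi> x)))"

text \<open>A phase is determined only modulo \<open>2\<pi>\<close>, and not at all where the field vanishes. The
  defining inequality is insensitive to this, so that quantifying the phase existentially yields
  a property of the field alone; see \<open>ellipticity_direction_iff\<close> below.\<close>

definition ellipticity_direction :: "(real^3) set \<Rightarrow> (real^3 \<Rightarrow> complex) \<Rightarrow> real \<Rightarrow> bool" where
  "ellipticity_direction D \<xi> \<theta> \<longleftrightarrow>
     (\<exists>\<phi>. phase_of D \<xi> \<phi> \<and>
        (\<exists>\<xi>m>0. AE x in lebesgue_on D. cmod (\<xi> x) * cos (\<theta> + \<phi> x) \<ge> \<xi>m))"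

definition elliptic :: "(real^3) set \<Rightarrow> (real^3 \<Rightarrow> complex) \<Rightarrow> bool" where
  "elliptic D \<xi> \<longleftrightarrow> (\<exists>\<theta>. ellipticity_direction D \<xi> \<theta>)"

lemma phase_of_cos:
  assumes "phase_of D \<xi> \<phi>"
  shows "AE x in lebesgue_on D. cmod (\<xi> x) * cos (\<theta> + \<phi> x) = Re (cis \<theta> * \<xi> x)"
  using assms unfolding phase_of_def
proof (rule AE_mp, intro AE_I2 impI)
  fix x assume eq: "\<xi> x = of_real (cmod (\<xi> x)) * exp (\<i> * of_real (\<phi> x))"
  have "cis \<theta> * (of_real (cmod (\<xi> x)) * exp (\<i> * of_real (\<phi> x)))
      = of_real (cmod (\<xi> x)) * cis (\<theta> + \<phi> x)"
    by (simp add: cis_conv_exp[symmetric] cis_mult[symmetric])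
  then have "cis \<theta> * \<xi> x = of_real (cmod (\<xi> x)) * cis (\<theta> + \<phi> x)"
    using eq by simp
  then show "cmod (\<xi> x) * cos (\<theta> + \<phi> x) = Re (cis \<theta> * \<xi> x)"
    by (metis Re_complex_of_real Im_complex_of_real cis.sel(1) diff_zero mult_zero_left times_complex.sel(1))
qed

lemma ellipticity_direction_iff:
  assumes "phase_of D \<xi> \<phi>"
  shows "ellipticity_direction D \<xi> \<theta> \<longleftrightarrow>
    (\<exists>\<xi>m>0. AE x in lebesgue_on D. cmod (\<xi> x) * cos (\<theta> + \<phi> x) \<ge> \<xi>m)"
proof
  assume "ellipticity_direction D \<xi> \<theta>"
  then obtain \<psi> c where "phase_of D \<xi> \<psi>" and c: "c > 0"
    and "AE x in lebesgue_on D. cmod (\<xi> x) * cos (\<theta> + \<psi> x) \<ge> c"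
    unfolding ellipticity_direction_def by blast
  with phase_of_cos[of D \<xi> \<psi> \<theta>] phase_of_cos[OF assms, of \<theta>]
  have "AE x in lebesgue_on D. cmod (\<xi> x) * cos (\<theta> + \<phi> x) \<ge> c"
    by (auto elim: eventually_elim2)
  with c show "\<exists>\<xi>m>0. AE x in lebesgue_on D. cmod (\<xi> x) * cos (\<theta> + \<phi> x) \<ge> \<xi>m"
    by blast
qed (use assms in \<open>auto simp: ellipticity_direction_def\<close>)

end

theory Submission
  imports Defs
begin

text \<open>An angle of the \<open>n\<close>-th interval shifts the phase range, modulo \<open>2\<pi>\<close>, into a compact
  subinterval of \<open>]-\<pi>/2, \<pi>/2[\<close>, where the cosine is bounded below by a positive constant; the
  modulus is bounded below by hypothesis. As the phase range is shorter than \<open>\<pi>\<close>, the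
  intervals are nonempty.\<close>

text \<open>Any real \<open>c\<close> strictly between 0 and the essential infimum works. Density of
  the reals in \<open>ereal\<close> provides one even when the essential infimum is
  infinite.\<close>

lemma essinf_pos_imp_AE_lower_bound:
  fixes f :: "'a \<Rightarrow> real"
  assumes "essinf M (\<lambda>x. ereal (f x)) > 0"
  obtains c where "c > 0" and "AE x in M. f x \<ge> c"
proof -
  obtain c where c: "0 < ereal c" "ereal c < essinf M (\<lambda>x. ereal (f x))"
    using ereal_dense2[OF assms] by blast
  have "AE x in M. - ereal (f x) \<le> esssup M (\<lambda>x. - ereal (f x))"
    by (rule esssup_AE)
  then have "AE x in M. f x \<ge> c"
  proof eventually_elim
    case (elim x)
    then have "essinf M (\<lambda>x. ereal (f x)) \<le> ereal (f x)"
      unfolding essinf_def by (metis ereal_minus_le_minus ereal_uminus_uminus)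
    with c(2) have "ereal c < ereal (f x)"
      by (rule less_le_trans)
    then show ?case by simp
  qed
  with c(1) show thesis
    using that by simp
qed

text \<open>Cosine is even and decreasing on \<open>[0, pi]\<close>, so its value at a bound
  \<open>r < pi/2\<close> for all \<open>\<bar>t\<bar>\<close> can serve as
  \<open>m\<close>.\<close>

lemma cos_lower_bound_on_Icc:
  fixes a b :: real
  assumes "- (pi / 2) < a" and "b < pi / 2"
  obtains m where "m > 0" and "\<And>t. t \<in> {a..b} \<Longrightarrow> cos t \<ge> m"
proof
  \<comment> \<open>The maximum with \<open>0\<close> covers \<open>b < a\<close>, when \<open>-a\<close> and \<open>b\<close> may both lie below \<open>-\<pi>/2\<close>.\<close>
  define r where "r = max 0 (max (- a) b)"
  show "cos r > 0"
    using assms pi_gt_zero unfolding r_def by (intro cos_gt_zero_pi) linarith+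
  show "cos t \<ge> cos r" if "t \<in> {a..b}" for t
  proof -
    have "\<bar>t\<bar> \<le> r" "r \<le> pi"
      using that assms pi_gt_zero by (auto simp: r_def)
    then have "cos r \<le> cos \<bar>t\<bar>"
      by (intro cos_monotone_0_pi_le) auto
    then show ?thesis by simp
  qed
qed

lemma ellipticity_direction_interval:
  assumes phase: "phase_of D \<xi> \<phi>"
    and range: "AE x in lebesgue_on D. \<phi> x \<in> {\<phi>m..\<phi>p}"
    and modulus: "essinf (lebesgue_on D) (\<lambda>x. ereal (cmod (\<xi> x))) > 0"
    and \<theta>: "\<theta> \<in> {2 * of_int n * pi - pi / 2 - \<phi>m <..< 2 * of_int n * pi + pi / 2 - \<phi>p}"
  shows "ellipticity_direction D \<xi> \<theta>"
proof -
  define s where "s = \<theta> - 2 * of_int n * pi"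
  obtain c where c: "c > 0" "AE x in lebesgue_on D. cmod (\<xi> x) \<ge> c"
    using essinf_pos_imp_AE_lower_bound[OF modulus] by blast
  have "- (pi / 2) < s + \<phi>m" "s + \<phi>p < pi / 2"
    using \<theta> by (auto simp: s_def)
  then obtain m where m: "m > 0" "\<And>t. t \<in> {s + \<phi>m..s + \<phi>p} \<Longrightarrow> cos t \<ge> m"
    using cos_lower_bound_on_Icc by blast
  from c(2) range have "AE x in lebesgue_on D. cmod (\<xi> x) * cos (\<theta> + \<phi> x) \<ge> c * m"
  proof eventually_elim
    case (elim x)
    have eq: "\<theta> + \<phi> x = (s + \<phi> x) + 2 * pi * of_int n"
      by (simp add: s_def)
    \<comment> \<open>In the addition formula, the cosine and sine at
      \<open>2 * pi * of_int n\<close> are 1 and 0.\<close>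
    have "cos (\<theta> + \<phi> x) = cos (s + \<phi> x)"
      unfolding eq cos_add[of "s + \<phi> x"] by simp
    then have "cos (\<theta> + \<phi> x) \<ge> m"
      using elim m(2)[of "s + \<phi> x"] by simp
    with elim c(1) m(1) show ?case
      by (intro mult_mono) auto
  qed
  moreover have "c * m > 0"
    using c m by simp
  ultimately show ?thesis
    using phase unfolding ellipticity_direction_def by blast
qed

theorem proposition3p7:
  fixes D :: "(real^3) set"
    and \<xi> :: "real^3 \<Rightarrow> complex"
    and \<phi> :: "real^3 \<Rightarrow> real"
    and \<phi>m \<phi>p :: real
  assumes "bounded D"
    and "D \<in> sets lebesgue"
    and "emeasure lebesgue D > 0"
    and "L_infinity D \<xi>"
    and "phase_of D \<xi> \<phi>"
    and "AE x in lebesgue_on D. \<phi> x \<in> {\<phi>m..\<phi>p}"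
    and "essinf (lebesgue_on D) (\<lambda>x. ereal (cmod (\<xi> x))) > 0"
    and "\<phi>p - \<phi>m < pi"
  shows "elliptic D \<xi> \<and>
    (\<forall>\<theta> \<in> (\<Union>n::int. {2 * of_int n * pi - pi / 2 - \<phi>m <..< 2 * of_int n * pi + pi / 2 - \<phi>p}).
       ellipticity_direction D \<xi> \<theta>)"
proof
  show directions: "\<forall>\<theta> \<in> (\<Union>n::int. {2 * of_int n * pi - pi / 2 - \<phi>m <..< 2 * of_int n * pi + pi / 2 - \<phi>p}).
      ellipticity_direction D \<xi> \<theta>"
    using ellipticity_direction_interval[OF assms(5-7)] by blast
  \<comment> \<open>The witness is the midpoint of the interval for \<open>n = 0\<close>, whose
    length \<open>pi - (\<phi>p - \<phi>m)\<close> is positive.\<close>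
  have "- (\<phi>m + \<phi>p) / 2 \<in> {2 * of_int 0 * pi - pi / 2 - \<phi>m <..< 2 * of_int 0 * pi + pi / 2 - \<phi>p}"
    using assms(8) by (simp add: field_simps)
  with directions show "elliptic D \<xi>"
    unfolding elliptic_def by blast
qed

end
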